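(* Let $r\ge1$, $s\ge2$, and let $P_1(\underline{x}),\ldots,P_s(\underline{x})\in\mathbb{Z}[\underline{x}]$, $\underline{x}=(x_1,\ldots,x_r)$, be nonzero polynomials with no common zero in $\mathbb{C}^r$. For $\underline{n}\in\mathbb{Z}^r$ put $d_{\underline{n}}=\gcd(P_1(\underline{n}),\ldots,P_s(\underline{n}))$, and let $\mathcal{D}=\{d_{\underline{n}}\mid\underline{n}\in\mathbb{Z}^r\}$. Then $\mathcal{D}$ is a finite subset of $\mathbb{Z}$ stable under gcd and lcm (if $d,d'\in\mathcal{D}$ then $\gcd(d,d')\in\mathcal{D}$ and $\operatorname{lcm}(d,d')\in\mathcal{D}$). In particular, the smallest positive element $d^\star$ of $\mathcal{D}$ is a common divisor of all elements of $\mathcal{D}$, and the largest positive element $\mu^\star$ of $\mathcal{D}$ is a common multiple of all elements of $\mathcal{D}$.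
   Context: The gcd of integers is the nonnegative one, with $\gcd(0,\ldots,0)=0$. *)

theory Defs
  imports
    Complex_Main
    "HOL-Library.Poly_Mapping"
    "HOL-Analysis.Finite_Cartesian_Product"
begin

text \<open>
  Polynomials with integer coefficients in the variables indexed by a finite type \<open>'r\<close>:
  a finitely supported family of coefficients, indexed by exponent vectors. The index type
  plays the role of \<open>{1, ..., r}\<close>; its cardinality \<open>r\<close> is arbitrary and automatically at least 1.
\<close>

type_synonym 'r int_mpoly = "('r \<Rightarrow>\<^sub>0 nat) \<Rightarrow>\<^sub>0 int"

definition mpoly_eval :: "'r::finite int_mpoly \<Rightarrow> 'a::comm_ring_1 ^ 'r \<Rightarrow> 'a" where
  "mpoly_eval p x =
     (\<Sum>m\<in>Poly_Mapping.keys p.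
        of_int (Poly_Mapping.lookup p m) * (\<Prod>j\<in>UNIV. (x $ j) ^ Poly_Mapping.lookup m j))"

definition gcd_at :: "nat \<Rightarrow> (nat \<Rightarrow> 'r::finite int_mpoly) \<Rightarrow> int ^ 'r \<Rightarrow> int" where
  "gcd_at s P n = (GCD i\<in>{1..s}. mpoly_eval (P i) n)"

definition gcd_values :: "nat \<Rightarrow> (nat \<Rightarrow> 'r::finite int_mpoly) \<Rightarrow> int set" where
  "gcd_values s P = range (gcd_at s P)"

end

theory Submission
  imports Defs
    "HOL-Analysis.Continuum_Not_Denumerable"
    "HOL-Library.Function_Algebras"
    "HOL-Computational_Algebra.Fundamental_Theorem_Algebra"
    "HOL-Number_Theory.Cong"
begin

text \<open>By the weak Nullstellensatz there is a Bezout identity \<open>\<Sum>A\<^sub>i P\<^sub>i = 1\<close> over \<open>\<complex>\<close>; a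
  \<open>\<rat>\<close>-linear map \<open>\<complex> \<rightarrow> \<rat>\<close> fixing 1, applied to the coefficients of the \<open>A\<^sub>i\<close>, makes it rational.
  Clearing denominators yields an integer \<open>N > 0\<close> that is a multiple of every \<open>d\<^sub>n\<close>.
  Given \<open>n\<close> and \<open>n'\<close>, write \<open>N = A B\<close> with \<open>A\<close> and \<open>B\<close> coprime such that at the primes dividing
  \<open>A\<close> (resp. \<open>B\<close>) the valuation of \<open>d\<^sub>n\<close> (resp. of \<open>d\<^sub>n\<^sub>'\<close>) is the smaller one. By the Chinese
  remainder theorem some \<open>m\<close> is congruent to \<open>n\<close> modulo \<open>A\<close> and to \<open>n'\<close> modulo \<open>B\<close>; as \<open>d\<^sub>m\<close>
  divides \<open>N\<close>, it is the gcd of \<open>d\<^sub>n\<close> and \<open>d\<^sub>n\<^sub>'\<close>. Exchanging \<open>n\<close> and \<open>n'\<close> gives the lcm.\<close>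

section \<open>Linear relations in spaces of countable dimension\<close>

text \<open>Each \<open>g i\<close> lies in the span of a finite subset of \<open>B\<close>. There
  are only countably many such subsets, so a single one, \<open>F\<close>, serves infinitely many
  indices, and a space spanned by a finite set has no infinite independent subset. The relation is
  between indices, so a repeated value of \<open>g\<close> also yields one.\<close>

lemma (in vector_space) uncountable_family_dependent:
  assumes "uncountable I" "countable B" "g ` I \<subseteq> span B"
  obtains T u where "finite T" "T \<subseteq> I" "(\<Sum>i\<in>T. scale (u i) (g i)) = 0" "\<exists>i\<in>T. u i \<noteq> 0"
proof -
  have "\<exists>F. finite F \<and> F \<subseteq> B \<and> g i \<in> span F" if "i \<in> I" for i
  proof -
    have "g i \<in> span B"
      using assms(3) that by blast
    then obtain F r where "finite F" "F \<subseteq> B" "g i = (\<Sum>v\<in>F. scale (r v) v)"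
      unfolding span_explicit by blast
    moreover from this have "g i \<in> span F"
      by (auto intro: span_sum span_scale span_base)
    ultimately show ?thesis by blast
  qed
  then obtain S where S: "\<And>i. i \<in> I \<Longrightarrow> finite (S i) \<and> S i \<subseteq> B \<and> g i \<in> span (S i)"
    by metis
  have "\<exists>F. finite F \<and> infinite {i \<in> I. S i = F}"
  proof (rule ccontr)
    assume *: "\<not> ?thesis"
    have "I = (\<Union>F \<in> {F. finite F \<and> F \<subseteq> B}. {i \<in> I. S i = F})"
      using S by auto
    moreover have "countable \<dots>"
      using * by (intro countable_UN countable_Collect_finite_subset assms(2)) (auto intro: countable_finite)
    ultimately show False
      using assms(1) by metis
  qed
  then obtain F where F: "finite F" "infinite {i \<in> I. S i = F}"
    by blast
  define J where "J = {i \<in> I. S i = F}"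
  have J: "J \<subseteq> I" "g ` J \<subseteq> span F" "infinite J"
    using S F by (auto simp: J_def)
  show ?thesis
  proof (cases "inj_on g J")
    case True
    then have "infinite (g ` J)"
      using J finite_imageD by blast
    then have "dependent (g ` J)"
      using independent_span_bound[OF F(1) _ J(2)] by blast
    then obtain t u where t: "finite t" "t \<subseteq> g ` J" "(\<Sum>v\<in>t. scale (u v) v) = 0" "\<exists>v\<in>t. u v \<noteq> 0"
      unfolding dependent_explicit by blast
    obtain T where T: "T \<subseteq> J" "t = g ` T"
      using t(2) subset_imageE by metis
    then have inj: "inj_on g T"
      using True inj_on_subset by blast
    show ?thesis
    proof (rule that[of T "\<lambda>i. u (g i)"])
      show "finite T"
        using t(1) T(2) inj finite_imageD by blast
      show "(\<Sum>i\<in>T. scale (u (g i)) (g i)) = 0"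
        using t(3) unfolding T(2) by (simp add: sum.reindex[OF inj])
    qed (use T J t in auto)
  next
    case False
    then obtain a b where ab: "a \<in> J" "b \<in> J" "a \<noteq> b" "g a = g b"
      by (auto simp: inj_on_def)
    show ?thesis
      by (rule that[of "{a, b}" "\<lambda>i. if i = a then 1 else -1"]) (use ab J in auto)
  qed
qed

section \<open>Polynomial functions and their expansion in monomials\<close>

definition fscale :: "'a::field \<Rightarrow> ('x \<Rightarrow> 'a) \<Rightarrow> 'x \<Rightarrow> 'a" where
  "fscale c f = (\<lambda>x. c * f x)"

interpretation fscale: vector_space fscale
  by standard (auto simp: fscale_def fun_eq_iff algebra_simps)

text \<open>Only values of polynomials matter below, so functions replace formal polynomials:
  evaluation is application, and the inductive form gives an induction over ring operations.\<close>

inductive_set polyfuns :: "('a::comm_ring_1 ^ 'r::finite \<Rightarrow> 'a) set" where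
  const: "(\<lambda>_. c) \<in> polyfuns"
| coord: "(\<lambda>x. x $ j) \<in> polyfuns"
| add: "f \<in> polyfuns \<Longrightarrow> g \<in> polyfuns \<Longrightarrow> f + g \<in> polyfuns"
| mult: "f \<in> polyfuns \<Longrightarrow> g \<in> polyfuns \<Longrightarrow> f * g \<in> polyfuns"

lemma polyfuns_0 [simp]: "0 \<in> polyfuns" and polyfuns_1 [simp]: "1 \<in> polyfuns"
  using polyfuns.const[of 0] polyfuns.const[of 1] by (simp_all add: zero_fun_def one_fun_def)

lemma polyfuns_uminus: "f \<in> polyfuns \<Longrightarrow> - f \<in> polyfuns"
  using polyfuns.mult[OF polyfuns.const[of "-1"], of f] by (simp add: times_fun_def fun_Compl_def)

lemma polyfuns_sum: "(\<And>i. i \<in> I \<Longrightarrow> f i \<in> polyfuns) \<Longrightarrow> (\<lambda>x. \<Sum>i\<in>I. f i x) \<in> polyfuns"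
proof (induction I rule: infinite_finite_induct)
  case (insert i I)
  then show ?case
    using polyfuns.add[of "f i" "\<lambda>x. \<Sum>i\<in>I. f i x"] by (simp add: plus_fun_def)
qed (simp_all add: polyfuns.const)

lemma polyfuns_prod: "(\<And>i. i \<in> I \<Longrightarrow> f i \<in> polyfuns) \<Longrightarrow> (\<lambda>x. \<Prod>i\<in>I. f i x) \<in> polyfuns"
proof (induction I rule: infinite_finite_induct)
  case (insert i I)
  then show ?case
    using polyfuns.mult[of "f i" "\<lambda>x. \<Prod>i\<in>I. f i x"] by (simp add: times_fun_def)
qed (simp_all add: polyfuns.const)

lemma polyfuns_power: "f \<in> polyfuns \<Longrightarrow> (\<lambda>x. f x ^ k) \<in> polyfuns"
  using polyfuns_prod[of "{..<k}" "\<lambda>_. f"] by simp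

lemma polyfuns_coord_poly: "(\<lambda>x. poly q (x $ j)) \<in> polyfuns"
  unfolding poly_altdef
  by (intro polyfuns_sum polyfuns.mult[unfolded times_fun_def] polyfuns.const polyfuns_power polyfuns.coord)

lemma polyfuns_mpoly_eval: "mpoly_eval p \<in> polyfuns"
proof -
  have "mpoly_eval p = (\<lambda>x. mpoly_eval p x)" by simp
  also have "\<dots> \<in> polyfuns"
    unfolding mpoly_eval_def
    by (intro polyfuns_sum polyfuns_prod polyfuns.mult[unfolded times_fun_def]
        polyfuns.const polyfuns_power polyfuns.coord)
  finally show ?thesis .
qed

definition monomial_fun :: "('r \<Rightarrow> nat) \<Rightarrow> 'a::comm_ring_1 ^ 'r::finite \<Rightarrow> 'a" where
  "monomial_fun m x = (\<Prod>j\<in>UNIV. x $ j ^ m j)"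

lemma monomial_fun_mult: "monomial_fun m * monomial_fun m' = monomial_fun (\<lambda>j. m j + m' j)"
  by (simp add: fun_eq_iff monomial_fun_def power_add prod.distrib)

lemma monomial_fun_span_mult:
  assumes "f \<in> fscale.span (range monomial_fun)" "g \<in> fscale.span (range monomial_fun)"
  shows "f * g \<in> fscale.span (range monomial_fun)"
  using assms(1)
proof (induction rule: fscale.span_induct_alt)
  case base
  show ?case by (simp add: fscale.span_zero[unfolded zero_fun_def])
next
  case (step c m y)
  have "m * g \<in> fscale.span (range monomial_fun)"
    using assms(2)
  proof (induction rule: fscale.span_induct_alt)
    case base
    show ?case by (simp add: fscale.span_zero[unfolded zero_fun_def])
  next
    case (step c' m' y')
    have "m * m' \<in> range monomial_fun"
      using \<open>m \<in> range monomial_fun\<close> step(1) by (auto simp: monomial_fun_mult)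
    then have "fscale c' (m * m') + m * y' \<in> fscale.span (range monomial_fun)"
      using step by (intro fscale.span_add fscale.span_scale[OF fscale.span_base])
    also have "fscale c' (m * m') + m * y' = m * (fscale c' m' + y')"
      by (simp add: fun_eq_iff fscale_def algebra_simps)
    finally show ?case .
  qed
  then have "fscale c (m * g) + y * g \<in> fscale.span (range monomial_fun)"
    using step by (intro fscale.span_add fscale.span_scale)
  also have "fscale c (m * g) + y * g = (fscale c m + y) * g"
    by (simp add: fun_eq_iff fscale_def algebra_simps)
  finally show ?case .
qed

text \<open>The expansion serves twice: it bounds the dimension of \<open>polyfuns\<close> by a
  countable set, and it later lets denominators be cleared one monomial at a time.\<close>

lemma polyfuns_span: "f \<in> polyfuns \<Longrightarrow> f \<in> fscale.span (range monomial_fun)"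
proof (induction rule: polyfuns.induct)
  case (const c)
  have "(\<lambda>_. c) = fscale c (monomial_fun (\<lambda>_. 0))"
    by (simp add: fun_eq_iff fscale_def monomial_fun_def)
  then show ?case
    by (metis fscale.span_base fscale.span_scale rangeI)
next
  case (coord j)
  have "(\<lambda>x. x $ j) = monomial_fun (\<lambda>i. if i = j then 1 else 0)"
    by (auto simp: fun_eq_iff monomial_fun_def if_distrib[of "(^) _"] cong: if_cong)
  then show ?case
    by (metis fscale.span_base rangeI)
qed (auto intro: fscale.span_add[unfolded plus_fun_def] monomial_fun_span_mult[unfolded times_fun_def])

section \<open>Ideals of polynomial functions and the weak Nullstellensatz\<close>

definition poly_ideal :: "('a::comm_ring_1 ^ 'r::finite \<Rightarrow> 'a) set \<Rightarrow> bool" where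
  "poly_ideal J \<longleftrightarrow> 0 \<in> J \<and> (\<forall>f\<in>J. \<forall>g\<in>J. f + g \<in> J) \<and> (\<forall>f\<in>J. \<forall>g\<in>polyfuns. g * f \<in> J)"

lemma poly_idealD:
  assumes "poly_ideal J"
  shows "0 \<in> J"
    and "f \<in> J \<Longrightarrow> g \<in> J \<Longrightarrow> f + g \<in> J"
    and "f \<in> J \<Longrightarrow> g \<in> polyfuns \<Longrightarrow> g * f \<in> J"
  using assms by (auto simp: poly_ideal_def)

lemma poly_ideal_uminus: "poly_ideal J \<Longrightarrow> f \<in> J \<Longrightarrow> - f \<in> J"
  using poly_idealD(3)[of J f "-1"] polyfuns_uminus[of 1] by simp

lemma poly_ideal_diff: "poly_ideal J \<Longrightarrow> f \<in> J \<Longrightarrow> g \<in> J \<Longrightarrow> f - g \<in> J"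
  using poly_idealD(2)[of J f "- g"] poly_ideal_uminus[of J g] by simp

lemma poly_ideal_sum: "poly_ideal J \<Longrightarrow> (\<And>i. i \<in> I \<Longrightarrow> f i \<in> J) \<Longrightarrow> sum f I \<in> J"
  by (induction I rule: infinite_finite_induct) (auto simp: poly_idealD)

text \<open>For an ideal \<open>J\<close> this is the smallest ideal containing \<open>J\<close> and
  \<open>h\<close>.\<close>

definition adjoin :: "('a::comm_ring_1 ^ 'r::finite \<Rightarrow> 'a) set \<Rightarrow> ('a ^ 'r \<Rightarrow> 'a) \<Rightarrow> ('a ^ 'r \<Rightarrow> 'a) set" where
  "adjoin J h = {f + g * h |f g. f \<in> J \<and> g \<in> polyfuns}"

lemma adjoinI: "f \<in> J \<Longrightarrow> g \<in> polyfuns \<Longrightarrow> k = f + g * h \<Longrightarrow> k \<in> adjoin J h"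
  by (auto simp: adjoin_def)

lemma poly_ideal_adjoin:
  assumes "poly_ideal J"
  shows "poly_ideal (adjoin J h)"
  unfolding poly_ideal_def
proof (intro conjI ballI)
  show "0 \<in> adjoin J h"
    by (rule adjoinI[of 0 _ 0]) (simp_all add: poly_idealD[OF assms])
next
  fix u v assume "u \<in> adjoin J h" "v \<in> adjoin J h"
  then obtain f g f' g' where "f \<in> J" "g \<in> polyfuns" "f' \<in> J" "g' \<in> polyfuns"
    and "u = f + g * h" "v = f' + g' * h"
    by (auto simp: adjoin_def)
  then show "u + v \<in> adjoin J h"
    by (intro adjoinI[of "f + f'" _ "g + g'"])
      (auto simp: algebra_simps intro: poly_idealD[OF assms] polyfuns.intros)
next
  fix u v :: "'a ^ 'b \<Rightarrow> 'a" assume v: "v \<in> polyfuns" and "u \<in> adjoin J h"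
  then obtain f g where "f \<in> J" "g \<in> polyfuns" "u = f + g * h"
    by (auto simp: adjoin_def)
  with v show "v * u \<in> adjoin J h"
    by (intro adjoinI[of "v * f" _ "v * g"])
      (auto simp: distrib_left mult.assoc intro: poly_idealD[OF assms] polyfuns.intros)
qed

lemma subset_adjoin: "J \<subseteq> adjoin J h"
  by (auto intro: adjoinI[of _ _ 0])

lemma mem_adjoin: "poly_ideal J \<Longrightarrow> h \<in> adjoin J h"
  by (auto intro: adjoinI[of 0 _ 1] simp: poly_idealD)

text \<open>The function \<open>g b\<close> is an inverse of \<open>x $ j - b\<close> modulo
  \<open>J\<close>. Since \<open>q\<close> splits over the complex numbers, its linear factors can
  be cancelled modulo \<open>J\<close> one root at a time, until a nonzero constant remains in
  \<open>J\<close>.\<close>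

lemma coord_poly_in_ideal_imp_unit:
  fixes J :: "(complex ^ 'r::finite \<Rightarrow> complex) set"
  assumes J: "poly_ideal J"
    and g: "\<And>b. g b \<in> polyfuns" "\<And>b. 1 - g b * (\<lambda>x. x $ j - b) \<in> J"
    and "q \<noteq> 0" "(\<lambda>x. poly q (x $ j)) \<in> J"
  shows "1 \<in> J"
  using assms(4,5)
proof (induction "degree q" arbitrary: q)
  case 0
  then obtain c where q: "q = [:c:]"
    by (metis degree_eq_zeroE)
  with 0 have "c \<noteq> 0" by simp
  moreover have "(\<lambda>_. 1 / c) * (\<lambda>x. poly q (x $ j)) \<in> J"
    using 0 by (intro poly_idealD(3)[OF J] polyfuns.const)
  ultimately show ?case
    by (simp add: q times_fun_def one_fun_def)
next
  case (Suc n)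
  have "\<not> constant (poly q)"
    using Suc(2) by (simp add: constant_degree)
  then obtain b where "poly q b = 0"
    using fundamental_theorem_of_algebra by blast
  then obtain q' where q': "q = [:- b, 1:] * q'"
    by (metis dvdE poly_eq_0_iff_dvd)
  with Suc have "q' \<noteq> 0" by auto
  then have deg: "n = degree q'"
    using Suc(2) q' by (simp add: degree_mult_eq del: mult_pCons_left)
  let ?f = "\<lambda>x. poly q' (x $ j)"
  have "g b * (\<lambda>x. poly q (x $ j)) + ?f * (1 - g b * (\<lambda>x. x $ j - b)) \<in> J"
    using Suc g by (intro poly_idealD(2,3)[OF J] polyfuns_coord_poly)
  also have "g b * (\<lambda>x. poly q (x $ j)) + ?f * (1 - g b * (\<lambda>x. x $ j - b)) = ?f"
    by (simp add: q' fun_eq_iff algebra_simps)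
  finally show ?case
    using Suc(1)[OF deg \<open>q' \<noteq> 0\<close>] by simp
qed

text \<open>If every \<open>x\<^sub>j - b\<close> were invertible modulo \<open>J\<close>, then the inverses, an uncountable
  family in a space of countable dimension, would satisfy a linear relation; clearing denominators
  turns it into a nonzero polynomial in \<open>x\<^sub>j\<close> alone that lies in \<open>J\<close>.\<close>

lemma adjoin_coord_proper:
  fixes J :: "(complex ^ 'r::finite \<Rightarrow> complex) set"
  assumes J: "poly_ideal J" "1 \<notin> J"
  shows "\<exists>b. 1 \<notin> adjoin J (\<lambda>x. x $ j - b)"
proof (rule ccontr)
  assume contr: "\<not> ?thesis"
  have "\<exists>g\<in>polyfuns. 1 - g * (\<lambda>x. x $ j - b) \<in> J" for b
  proof -
    have "1 \<in> adjoin J (\<lambda>x. x $ j - b)"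
      using contr by blast
    then obtain f g where fg: "f \<in> J" "g \<in> polyfuns" "1 = f + g * (\<lambda>x. x $ j - b)"
      unfolding adjoin_def by blast
    have "1 - g * (\<lambda>x. x $ j - b) = f"
      unfolding fg(3) by (rule add_diff_cancel_right')
    with fg show ?thesis by blast
  qed
  then obtain g where g: "\<And>b. g b \<in> polyfuns" "\<And>b. 1 - g b * (\<lambda>x. x $ j - b) \<in> J"
    by metis
  \<comment> \<open>Exponent vectors are functions from a finite type to \<open>nat\<close>, so
    their type is countable.\<close>
  have cnt: "countable (range (monomial_fun :: ('r \<Rightarrow> nat) \<Rightarrow> complex ^ 'r \<Rightarrow> complex))"
    by (intro countable_image countableI_type)
  have sp: "range g \<subseteq> fscale.span (range monomial_fun)"
    by (rule image_subsetI) (rule polyfuns_span[OF g(1)])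
  obtain T u where T: "finite T" "T \<subseteq> UNIV" "(\<Sum>b\<in>T. fscale (u b) (g b)) = 0" "\<exists>b\<in>T. u b \<noteq> 0"
    by (rule fscale.uncountable_family_dependent[OF uncountable_UNIV_complex cnt sp])
  \<comment> \<open>Modulo \<open>J\<close> the relation reads: the sum of
    \<open>u b / (x $ j - b)\<close> over \<open>T\<close> is 0. Multiplying by the product of all
    \<open>x $ j - c\<close> gives the numerator \<open>q\<close>, where \<open>L b\<close> is that
    product without the factor of \<open>b\<close>.\<close>
  define L where "L b = (\<Prod>c\<in>T - {b}. [:- c, 1:])" for b
  define q where "q = (\<Sum>b\<in>T. smult (u b) (L b))"
  obtain a where a: "a \<in> T" "u a \<noteq> 0"
    using T by blast
  \<comment> \<open>At \<open>a\<close> every \<open>L b\<close> with \<open>b \<noteq> a\<close>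
    vanishes, as in Lagrange interpolation.\<close>
  have "poly q a = (\<Sum>b\<in>T. if b = a then u a * poly (L a) a else 0)"
    unfolding q_def poly_sum using T a
    by (intro sum.cong refl) (auto simp: L_def poly_prod intro!: prod_zero)
  also have "\<dots> = u a * poly (L a) a"
    using T a by simp
  also have "\<dots> \<noteq> 0"
    using a T by (simp add: L_def poly_prod)
  finally have "q \<noteq> 0" by auto
  \<comment> \<open>In this combination of elements of \<open>J\<close>, the terms containing
    \<open>g b\<close> share the full product \<open>?P\<close> as a factor and cancel by the linear
    relation; what is left is \<open>q\<close> at \<open>x $ j\<close>.\<close>
  have "(\<Sum>b\<in>T. ((\<lambda>x. u b * poly (L b) (x $ j))) * (1 - g b * (\<lambda>x. x $ j - b))) \<in> J"
    using g(2) by (intro poly_ideal_sum[OF J(1)] poly_idealD(3)[OF J(1)]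
      polyfuns.mult[unfolded times_fun_def] polyfuns.const polyfuns_coord_poly)
  also have "(\<Sum>b\<in>T. ((\<lambda>x. u b * poly (L b) (x $ j))) * (1 - g b * (\<lambda>x. x $ j - b)))
     = (\<lambda>x. poly q (x $ j))"
  proof
    fix x :: "complex ^ 'r"
    let ?P = "\<Prod>c\<in>T. x $ j - c"
    have sum_apply: "(\<Sum>b\<in>T. F b) x = (\<Sum>b\<in>T. F b x)" for F :: "complex \<Rightarrow> complex ^ 'r \<Rightarrow> complex"
      by (induction T rule: infinite_finite_induct) auto
    have P: "poly (L b) (x $ j) * (x $ j - b) = ?P" if "b \<in> T" for b
      using that T by (subst prod.remove[of T b]) (auto simp: L_def poly_prod)
    have "(\<Sum>b\<in>T. ((\<lambda>x. u b * poly (L b) (x $ j))) * (1 - g b * (\<lambda>x. x $ j - b))) x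
      = (\<Sum>b\<in>T. u b * poly (L b) (x $ j) - u b * g b x * (poly (L b) (x $ j) * (x $ j - b)))"
      unfolding sum_apply by (simp add: algebra_simps)
    also have "\<dots> = (\<Sum>b\<in>T. u b * poly (L b) (x $ j) - u b * g b x * ?P)"
      by (intro sum.cong) (auto simp: P)
    also have "\<dots> = (\<Sum>b\<in>T. u b * poly (L b) (x $ j)) - (\<Sum>b\<in>T. fscale (u b) (g b)) x * ?P"
      unfolding sum_apply by (simp add: sum_subtractf sum_distrib_right fscale_def)
    also have "\<dots> = poly q (x $ j)"
      unfolding T(3) by (simp add: q_def poly_sum)
    finally show "(\<Sum>b\<in>T. ((\<lambda>x. u b * poly (L b) (x $ j))) * (1 - g b * (\<lambda>x. x $ j - b))) x
      = poly q (x $ j)" .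
  qed
  finally have "1 \<in> J"
    by (rule coord_poly_in_ideal_imp_unit[where g = g, OF J(1) g \<open>q \<noteq> 0\<close>])
  with J(2) show False by contradiction
qed

text \<open>Finitely many coordinates are treated one by one, each time adjoining some
  \<open>x $ k - c\<close> that keeps the ideal proper; no maximal ideal has to be chosen.\<close>

lemma proper_ideal_contains_point:
  fixes J :: "(complex ^ 'r::finite \<Rightarrow> complex) set"
  assumes J: "poly_ideal J" "1 \<notin> J"
  shows "\<exists>J' b. poly_ideal J' \<and> 1 \<notin> J' \<and> J \<subseteq> J' \<and> (\<forall>j. (\<lambda>x. x $ j - b $ j) \<in> J')"
proof -
  have "\<exists>J' b. poly_ideal J' \<and> 1 \<notin> J' \<and> J \<subseteq> J' \<and> (\<forall>j\<in>V. (\<lambda>x. x $ j - b j) \<in> J')" for V :: "'r set"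
    using finite[of V]
  proof (induction V rule: finite_induct)
    case empty
    then show ?case using J by blast
  next
    case (insert k V)
    then obtain J' b where J': "poly_ideal J'" "1 \<notin> J'" "J \<subseteq> J'" "\<forall>j\<in>V. (\<lambda>x. x $ j - b j) \<in> J'"
      by blast
    then obtain c where c: "1 \<notin> adjoin J' (\<lambda>x. x $ k - c)"
      using adjoin_coord_proper by blast
    show ?case
    proof (intro exI conjI)
      show "\<forall>j\<in>insert k V. (\<lambda>x. x $ j - (b(k := c)) j) \<in> adjoin J' (\<lambda>x. x $ k - c)"
        using J' subset_adjoin[of J'] insert(2) by (auto simp: mem_adjoin)
      show "1 \<notin> adjoin J' (\<lambda>x. x $ k - c)"
        by (fact c)
      show "J \<subseteq> adjoin J' (\<lambda>x. x $ k - c)"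
        using J'(3) subset_adjoin by blast
    qed (rule poly_ideal_adjoin[OF J'(1)])
  qed
  from this[of UNIV] obtain J' b where
    "poly_ideal J'" "1 \<notin> J'" "J \<subseteq> J'" "\<forall>j. (\<lambda>x. x $ j - b j) \<in> J'"
    by auto
  then show ?thesis
    by (intro exI[of _ J'] exI[of _ "\<chi> j. b j"]) auto
qed

text \<open>Modulo \<open>J\<close> each coordinate is the constant \<open>b $ j\<close>, hence each
  polynomial function is congruent to its value at \<open>b\<close>.\<close>

lemma diff_value_in_ideal:
  assumes J: "poly_ideal J" and b: "\<And>j. (\<lambda>x. x $ j - b $ j) \<in> J" and "f \<in> polyfuns"
  shows "f - (\<lambda>_. f b) \<in> J"
  using assms(3)
proof (induction rule: polyfuns.induct)
  case (const c)
  have "(\<lambda>_. c) - (\<lambda>_. c) = (0 :: 'a ^ 'b \<Rightarrow> 'a)"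
    by simp
  then show ?case
    using poly_idealD(1)[OF J] by metis
next
  case (coord j)
  then show ?case
    using b[of j] by (simp add: fun_diff_def)
next
  case (add f g)
  have "f + g - (\<lambda>_. (f + g) b) = (f - (\<lambda>_. f b)) + (g - (\<lambda>_. g b))"
    by (simp add: fun_eq_iff)
  then show ?case
    using poly_idealD(2)[OF J add.IH] by (simp add: plus_fun_def fun_diff_def)
next
  case (mult f g)
  have "g * (f - (\<lambda>_. f b)) + (\<lambda>_. f b) * (g - (\<lambda>_. g b)) \<in> J"
    using mult by (intro poly_idealD(2,3)[OF J] polyfuns.const)
  also have "g * (f - (\<lambda>_. f b)) + (\<lambda>_. f b) * (g - (\<lambda>_. g b)) = f * g - (\<lambda>_. (f * g) b)"
    by (simp add: fun_eq_iff algebra_simps)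
  finally show ?case
    by (simp add: times_fun_def)
qed

text \<open>If some \<open>f\<close> in \<open>J\<close> had \<open>f b \<noteq> 0\<close>, the
  nonzero constant \<open>f b\<close> would lie in the proper ideal \<open>J'\<close> that contains
  \<open>J\<close> and the point \<open>b\<close>.\<close>

theorem weak_nullstellensatz:
  fixes J :: "(complex ^ 'r::finite \<Rightarrow> complex) set"
  assumes J: "poly_ideal J" "J \<subseteq> polyfuns" "1 \<notin> J"
  shows "\<exists>b. \<forall>f\<in>J. f b = 0"
proof -
  obtain J' b where J': "poly_ideal J'" "1 \<notin> J'" "J \<subseteq> J'" "\<And>j. (\<lambda>x. x $ j - b $ j) \<in> J'"
    using proper_ideal_contains_point[OF J(1,3)] by blast
  have "f b = 0" if "f \<in> J" for f
  proof (rule ccontr)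
    assume "f b \<noteq> 0"
    have "f - (f - (\<lambda>_. f b)) \<in> J'"
      using that J' J by (intro poly_ideal_diff diff_value_in_ideal) auto
    then have "(\<lambda>_. 1 / f b) * (\<lambda>_. f b) \<in> J'"
      by (intro poly_idealD(3)[OF J'(1)] polyfuns.const) simp
    with \<open>f b \<noteq> 0\<close> J'(2) show False
      by (simp add: times_fun_def one_fun_def)
  qed
  then show ?thesis by blast
qed

text \<open>The combinations of the \<open>P i\<close> form an ideal without a common zero, so it
  contains 1.\<close>

corollary bezout_of_no_common_zero:
  fixes P :: "'i \<Rightarrow> complex ^ 'r::finite \<Rightarrow> complex"
  assumes "finite I" "\<And>i. i \<in> I \<Longrightarrow> P i \<in> polyfuns" "\<not> (\<exists>z. \<forall>i\<in>I. P i z = 0)"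
  obtains A where "\<And>i. A i \<in> polyfuns" "\<And>z. (\<Sum>i\<in>I. A i z * P i z) = 1"
proof -
  define J where "J = {(\<lambda>z. \<Sum>i\<in>I. A i z * P i z) |A. \<forall>i. A i \<in> polyfuns}"
  have JI: "h \<in> J" if "\<And>i. A i \<in> polyfuns" "h = (\<lambda>z. \<Sum>i\<in>I. A i z * P i z)" for A h
    using that by (auto simp: J_def)
  have "poly_ideal J"
    unfolding poly_ideal_def
  proof (intro conjI ballI)
    show "0 \<in> J"
      by (rule JI[of "\<lambda>_. 0"]) (simp, simp add: zero_fun_def)
  next
    fix f g assume "f \<in> J" "g \<in> J"
    then obtain A B where AB: "\<And>i. A i \<in> polyfuns" "f = (\<lambda>z. \<Sum>i\<in>I. A i z * P i z)"
      "\<And>i. B i \<in> polyfuns" "g = (\<lambda>z. \<Sum>i\<in>I. B i z * P i z)"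
      by (auto simp: J_def)
    show "f + g \<in> J"
      by (rule JI[of "\<lambda>i. A i + B i"])
        (auto simp: AB fun_eq_iff algebra_simps sum.distrib intro: polyfuns.add)
  next
    fix f g :: "complex ^ 'r \<Rightarrow> complex" assume g: "g \<in> polyfuns" and "f \<in> J"
    then obtain A where A: "\<And>i. A i \<in> polyfuns" "f = (\<lambda>z. \<Sum>i\<in>I. A i z * P i z)"
      by (auto simp: J_def)
    show "g * f \<in> J"
      by (rule JI[of "\<lambda>i. g * A i"])
        (auto simp: A fun_eq_iff algebra_simps sum_distrib_left intro: polyfuns.mult g)
  qed
  moreover have "J \<subseteq> polyfuns"
    by (auto simp: J_def intro!: polyfuns_sum polyfuns.mult[unfolded times_fun_def] assms)
  moreover have "P i \<in> J" if "i \<in> I" for i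
    by (rule JI[of "\<lambda>k. if k = i then 1 else 0"])
      (use assms(1) that in \<open>auto simp: fun_eq_iff if_distrib[of "\<lambda>f. f _"] if_distrib[of "\<lambda>c. c * _"] cong: if_cong\<close>)
  ultimately have "1 \<in> J"
    using weak_nullstellensatz[of J] assms(3) by blast
  then show ?thesis
    using that by (force simp: J_def fun_eq_iff)
qed

section \<open>From the complex Bezout identity to an integer multiple of all gcds\<close>

definition vec_of_int :: "int ^ 'r::finite \<Rightarrow> 'a::comm_ring_1 ^ 'r" where
  "vec_of_int n = (\<chi> j. of_int (n $ j))"

lemma mpoly_eval_vec_of_int: "mpoly_eval p (vec_of_int n) = of_int (mpoly_eval p n)"
  by (simp add: mpoly_eval_def vec_of_int_def)

text \<open>The set \<open>{1}\<close> is independent over the rationals, so a linear map can be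
  prescribed on it and extended. Integer values of the polynomials can then be pulled out of
  \<open>\<phi>\<close>.\<close>

lemma rat_linear_functional:
  obtains \<phi> :: "complex \<Rightarrow> rat"
  where "\<And>x y. \<phi> (x + y) = \<phi> x + \<phi> y" "\<And>q x. \<phi> (of_rat q * x) = q * \<phi> x" "\<phi> 1 = 1"
proof -
  interpret vector_space_pair "\<lambda>q (z::complex). of_rat q * z" "(*) :: rat \<Rightarrow> rat \<Rightarrow> rat"
    by standard (simp_all add: algebra_simps of_rat_add of_rat_mult)
  have "vs1.independent {1}"
    by simp
  from linear_independent_extend[OF this, of "\<lambda>_. 1"] obtain \<phi>
    where \<phi>: "Vector_Spaces.linear (\<lambda>q (z::complex). of_rat q * z) (*) \<phi>" "\<phi> 1 = 1"
    by blast
  show ?thesis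
    by (rule that[of \<phi>]) (simp_all add: linear_add[OF \<phi>(1)] linear_scale[OF \<phi>(1)] \<phi>(2))
qed

text \<open>Monomials take integer values at integer points, so \<open>\<phi>\<close> of the value
  of \<open>f\<close> is an integer combination of \<open>\<phi>\<close> of its finitely many
  coefficients. The product of their denominators works for all \<open>n\<close> at once.\<close>

lemma bounded_denominators:
  fixes \<phi> :: "complex \<Rightarrow> rat"
  assumes \<phi>: "\<And>x y. \<phi> (x + y) = \<phi> x + \<phi> y" "\<And>q x. \<phi> (of_rat q * x) = q * \<phi> x"
    and "f \<in> polyfuns"
  shows "\<exists>N>0. \<forall>n. of_int N * \<phi> (f (vec_of_int n)) \<in> \<int>"
  using polyfuns_span[OF assms(3)]
proof (induction rule: fscale.span_induct_alt)
  case base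
  have "\<phi> 0 = 0"
    using \<phi>(2)[of 0 0] by simp
  then show ?case
    by (intro exI[of _ 1]) simp
next
  case (step c m y)
  then obtain N k where N: "N > 0" "\<And>n. of_int N * \<phi> (y (vec_of_int n)) \<in> \<int>" "m = monomial_fun k"
    by blast
  obtain a d where ad: "quotient_of (\<phi> c) = (a, d)"
    by fastforce
  then have d: "d > 0" "of_int d * \<phi> c = of_int a"
    using quotient_of_denom_pos[OF ad] quotient_of_div[OF ad] by auto
  have "of_int (N * d) * \<phi> ((fscale c m + y) (vec_of_int n)) \<in> \<int>" for n
  proof -
    let ?k = "monomial_fun k n"
    have "m (vec_of_int n) = of_int ?k"
      by (simp add: N(3) monomial_fun_def vec_of_int_def)
    then have "m (vec_of_int n) = of_rat (of_int ?k)"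
      by simp
    then have "\<phi> ((fscale c m + y) (vec_of_int n)) = of_int ?k * \<phi> c + \<phi> (y (vec_of_int n))"
      using \<phi>(2)[of "of_int ?k" c] by (simp add: \<phi>(1) fscale_def mult.commute)
    then have "of_int (N * d) * \<phi> ((fscale c m + y) (vec_of_int n))
      = of_int (N * ?k) * (of_int d * \<phi> c) + of_int d * (of_int N * \<phi> (y (vec_of_int n)))"
      by (simp add: algebra_simps)
    also have "\<dots> \<in> \<int>"
      unfolding d(2) by (intro Ints_add Ints_mult[OF Ints_of_int] N(2) Ints_of_int)
    finally show ?thesis .
  qed
  moreover have "N * d > 0"
    using N d by simp
  ultimately show ?case by blast
qed

text \<open>Applying \<open>\<phi>\<close> to the Bezout identity at an integer point writes 1 as a
  combination of the integers \<open>mpoly_eval (P i) n\<close> with rational coefficients of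
  bounded denominator. Multiplied by \<open>N\<close>, the coefficients become integers.\<close>

lemma gcd_at_dvd_constant:
  fixes P :: "nat \<Rightarrow> 'r::finite int_mpoly"
  assumes "\<not> (\<exists>z :: complex ^ 'r. \<forall>i\<in>{1..s}. mpoly_eval (P i) z = 0)"
  obtains N :: int where "N > 0" "\<And>n. gcd_at s P n dvd N"
proof -
  obtain A :: "nat \<Rightarrow> complex ^ 'r \<Rightarrow> complex" where A: "\<And>i. A i \<in> polyfuns"
    "\<And>z. (\<Sum>i\<in>{1..s}. A i z * mpoly_eval (P i) z) = 1"
    using bezout_of_no_common_zero[of "{1..s}" "\<lambda>i. mpoly_eval (P i)"] assms polyfuns_mpoly_eval
    by blast
  obtain \<phi> :: "complex \<Rightarrow> rat"
    where \<phi>: "\<And>x y. \<phi> (x + y) = \<phi> x + \<phi> y" "\<And>q x. \<phi> (of_rat q * x) = q * \<phi> x" "\<phi> 1 = 1"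
    using rat_linear_functional by blast
  have \<phi>0: "\<phi> 0 = 0"
    using \<phi>(2)[of 0 0] by simp
  have \<phi>_sum: "\<phi> (sum f I) = (\<Sum>i\<in>I. \<phi> (f i))" for f and I :: "nat set"
    by (induction I rule: infinite_finite_induct) (auto simp: \<phi>0 \<phi>(1))
  obtain M where M: "\<And>i. M i > 0" "\<And>i n. of_int (M i) * \<phi> (A i (vec_of_int n)) \<in> \<int>"
    using bounded_denominators[OF \<phi>(1,2) A(1)] by metis
  define N where "N = (\<Prod>i\<in>{1..s}. M i)"
  have "N > 0"
    unfolding N_def using M(1) by (intro prod_pos) auto
  moreover have "gcd_at s P n dvd N" for n
  proof -
    have "\<exists>k. of_int N * \<phi> (A i (vec_of_int n)) = of_int k" if "i \<in> {1..s}" for i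
    proof -
      have "N = M i * (\<Prod>i\<in>{1..s} - {i}. M i)"
        unfolding N_def using that by (intro prod.remove) auto
      then have "of_int N * \<phi> (A i (vec_of_int n))
        = of_int (\<Prod>i\<in>{1..s} - {i}. M i) * (of_int (M i) * \<phi> (A i (vec_of_int n)))"
        by (simp add: algebra_simps)
      also have "\<dots> \<in> \<int>"
        by (intro Ints_mult[OF Ints_of_int M(2)])
      finally show ?thesis
        by (auto elim: Ints_cases)
    qed
    then obtain k where k: "\<And>i. i \<in> {1..s} \<Longrightarrow> of_int N * \<phi> (A i (vec_of_int n)) = of_int (k i)"
      by metis
    have "1 = \<phi> (\<Sum>i\<in>{1..s}. A i (vec_of_int n) * mpoly_eval (P i) (vec_of_int n))"
      by (simp only: A(2) \<phi>(3))
    also have "\<dots> = (\<Sum>i\<in>{1..s}. of_int (mpoly_eval (P i) n) * \<phi> (A i (vec_of_int n)))"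
      unfolding \<phi>_sum using \<phi>(2)[of "of_int _"]
      by (simp add: mpoly_eval_vec_of_int mult.commute)
    finally have "of_int N = of_int N * (\<Sum>i\<in>{1..s}. of_int (mpoly_eval (P i) n) * \<phi> (A i (vec_of_int n)))"
      by simp
    also have "\<dots> = (\<Sum>i\<in>{1..s}. of_int (mpoly_eval (P i) n) * (of_int N * \<phi> (A i (vec_of_int n))))"
      by (simp add: sum_distrib_left algebra_simps)
    also have "\<dots> = (\<Sum>i\<in>{1..s}. of_int (mpoly_eval (P i) n) * of_int (k i))"
      by (intro sum.cong) (simp_all add: k)
    also have "\<dots> = of_int (\<Sum>i\<in>{1..s}. mpoly_eval (P i) n * k i)"
      by simp
    finally have "N = (\<Sum>i\<in>{1..s}. mpoly_eval (P i) n * k i)"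
      by (simp only: of_int_eq_iff)
    also have "gcd_at s P n dvd \<dots>"
      unfolding gcd_at_def by (intro dvd_sum dvd_mult2 Gcd_dvd) auto
    finally show ?thesis .
  qed
  ultimately show ?thesis
    using that by blast
qed

section \<open>Congruences, coprime factorizations and gluing of points\<close>

lemma mpoly_eval_cong:
  fixes n m :: "int ^ 'r::finite"
  assumes "\<And>j. [n $ j = m $ j] (mod k)"
  shows "[mpoly_eval p n = mpoly_eval p m] (mod k)"
  unfolding mpoly_eval_def
  by (intro cong_sum cong_mult cong_prod cong_pow cong_refl assms)

text \<open>The values of the \<open>P i\<close> modulo \<open>k\<close> depend only on the point
  modulo \<open>k\<close>. The situation is symmetric in \<open>n\<close> and \<open>m\<close>, so
  one divisibility suffices.\<close>

lemma gcd_gcd_at_cong: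
  assumes "\<And>j. [n $ j = m $ j] (mod k)"
  shows "gcd (gcd_at s P n) k = gcd (gcd_at s P m) k"
proof -
  have "gcd (gcd_at s P n) k dvd gcd (gcd_at s P m) k"
    if c: "\<And>j. [n $ j = m $ j] (mod k)" for n m
  proof (rule gcd_greatest)
    let ?d = "gcd (gcd_at s P n) k"
    show "?d dvd gcd_at s P m"
      unfolding gcd_at_def[of s P m]
    proof (rule Gcd_greatest, safe)
      fix i assume i: "i \<in> {1..s}"
      have "[mpoly_eval (P i) n = mpoly_eval (P i) m] (mod ?d)"
        using mpoly_eval_cong[OF c] by (rule cong_dvd_modulus) simp
      moreover have "?d dvd mpoly_eval (P i) n"
        using i by (auto simp: gcd_at_def intro!: dvd_trans[OF gcd_dvd1] Gcd_dvd)
      ultimately show "?d dvd mpoly_eval (P i) m"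
        by (simp add: cong_dvd_iff)
    qed
  qed simp
  from this[OF assms] this[OF cong_sym[OF assms]] show ?thesis
    by (intro zdvd_antisym_nonneg) auto
qed

lemma gcd_mult_coprime_split:
  fixes a b d :: int
  assumes "coprime a b"
  shows "gcd d (a * b) = gcd d a * gcd d b"
proof (rule zdvd_antisym_nonneg)
  obtain a' b' where g: "gcd d (a * b) = a' * b'" "a' dvd a" "b' dvd b"
    using division_decomp[of "gcd d (a * b)" a b] by auto
  then have "a' dvd d" "b' dvd d"
    by (metis gcd_dvd1 dvd_mult_left, metis gcd_dvd1 dvd_mult_right)
  with g show "gcd d (a * b) dvd gcd d a * gcd d b"
    by (simp add: mult_dvd_mono)
  have "coprime (gcd d a) (gcd d b)"
    using assms by (meson coprime_divisors gcd_dvd2)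
  then show "gcd d a * gcd d b dvd gcd d (a * b)"
    by (intro gcd_greatest divides_mult mult_dvd_mono) auto
qed auto

text \<open>Induction on \<open>N\<close>, removing the full power \<open>p ^ e\<close> of a prime.
  The parts of \<open>d\<close> and \<open>d'\<close> at \<open>p\<close> are powers of
  \<open>p\<close>, so one divides the other; accordingly \<open>p ^ e\<close> joins
  \<open>A\<close> or \<open>B\<close>.\<close>

lemma coprime_split:
  fixes N d d' :: int
  assumes "N > 0"
  shows "\<exists>A B. N = A * B \<and> coprime A B \<and> gcd d A dvd d' \<and> gcd d' B dvd d"
  using assms
proof (induction "nat N" arbitrary: N rule: less_induct)
  case less
  show ?case
  proof (cases "N = 1")
    case True
    then show ?thesis
      by (intro exI[of _ 1]) simp
  next
    case False
    then obtain p where p: "prime p" "p dvd N"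
      using less.prems prime_divisor_exists[of N] by auto
    define e where "e = multiplicity p N"
    obtain M where M: "N = p ^ e * M" "\<not> p dvd M"
      using multiplicity_decompose'[of N p] less.prems not_prime_unit[of p] p unfolding e_def by blast
    have "p > 1"
      using p(1) by (rule prime_gt_1_int)
    moreover have "e > 0"
      using p(2) M by (cases "e = 0") auto
    ultimately have pe: "p ^ e > 1"
      by simp
    have "M > 0"
      using M(1) \<open>p > 1\<close> less.prems by (simp add: zero_less_mult_iff)
    with M pe have "M < N" by simp
    with less.hyps[of M] \<open>M > 0\<close> obtain A B where AB: "M = A * B" "coprime A B"
      "gcd d A dvd d'" "gcd d' B dvd d"
      by auto
    have cop: "coprime (p ^ e) A" "coprime (p ^ e) B"
      using p M AB by (auto intro!: prime_imp_coprime simp: coprime_power_left_iff)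
    have "\<exists>i. gcd a (p ^ e) = p ^ i" for a
      using divides_primepow[OF p(1), of "gcd a (p ^ e)" e] by auto
    then have "gcd d (p ^ e) dvd gcd d' (p ^ e) \<or> gcd d' (p ^ e) dvd gcd d (p ^ e)"
      using le_imp_power_dvd nat_le_linear by metis
    then consider "gcd d (p ^ e) dvd d'" | "gcd d' (p ^ e) dvd d"
      by (meson dvd_trans gcd_dvd1)
    then show ?thesis
    proof cases
      case 1
      have "coprime (gcd d (p ^ e)) (gcd d A)"
        using coprime_divisors[OF gcd_dvd2 gcd_dvd2 cop(1)] .
      with 1 AB(3) have "gcd d (p ^ e * A) dvd d'"
        unfolding gcd_mult_coprime_split[OF cop(1)] by (simp add: divides_mult)
      moreover have "N = p ^ e * A * B"
        by (simp only: M(1) AB(1) mult.assoc)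
      moreover have "coprime (p ^ e * A) B"
        using AB(2) cop(2) unfolding coprime_mult_left_iff by blast
      ultimately show ?thesis
        using AB(4) by blast
    next
      case 2
      have "coprime (gcd d' (p ^ e)) (gcd d' B)"
        using coprime_divisors[OF gcd_dvd2 gcd_dvd2 cop(2)] .
      with 2 AB(4) have "gcd d' (p ^ e * B) dvd d"
        unfolding gcd_mult_coprime_split[OF cop(2)] by (simp add: divides_mult)
      moreover have "N = A * (p ^ e * B)"
        by (simp only: M(1) AB(1) mult.left_commute)
      moreover have "coprime A (p ^ e * B)"
        using AB(2) coprime_commute[of "p ^ e" A] cop(1) unfolding coprime_mult_right_iff by blast
      ultimately show ?thesis
        using AB(3) by blast
    qed
  qed
qed

text \<open>The Chinese remainder theorem, coordinate by coordinate, gives a point that looks like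
  \<open>n\<close> modulo \<open>A\<close> and like \<open>n'\<close> modulo \<open>B\<close>. Its
  gcd divides \<open>A * B\<close>, so it is determined by its parts at \<open>A\<close> and
  \<open>B\<close>.\<close>

lemma gcd_at_glue:
  assumes "coprime A B" "\<And>n. gcd_at s P n dvd A * B"
  obtains m where "gcd_at s P m = gcd (gcd_at s P n) A * gcd (gcd_at s P n') B"
proof -
  have "\<forall>j. \<exists>x. [x = n $ j] (mod A) \<and> [x = n' $ j] (mod B)"
    using binary_chinese_remainder_int[OF assms(1)] by blast
  then obtain x where x: "\<And>j. [x j = n $ j] (mod A)" "\<And>j. [x j = n' $ j] (mod B)"
    by metis
  define m where "m = (\<chi> j. x j)"
  have "gcd_at s P m \<ge> 0"
    by (simp add: gcd_at_def)
  then have "gcd_at s P m = gcd (gcd_at s P m) (A * B)"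
    using assms(2)[of m] by (simp add: gcd_proj1_if_dvd_int)
  also have "\<dots> = gcd (gcd_at s P m) A * gcd (gcd_at s P m) B"
    by (rule gcd_mult_coprime_split[OF assms(1)])
  also have "gcd (gcd_at s P m) A = gcd (gcd_at s P n) A"
    by (rule gcd_gcd_at_cong) (simp add: m_def x)
  also have "gcd (gcd_at s P m) B = gcd (gcd_at s P n') B"
    by (rule gcd_gcd_at_cong) (simp add: m_def x)
  finally show ?thesis
    using that by blast
qed

text \<open>The first product takes the smaller part on each side, the second the larger
  one.\<close>

lemma coprime_split_gcd_lcm:
  fixes d d' A B :: int
  assumes "d > 0" "d' > 0" "d dvd A * B" "d' dvd A * B" "coprime A B"
    and "gcd d A dvd d'" "gcd d' B dvd d"
  shows "gcd d A * gcd d' B = gcd d d'" "gcd d' A * gcd d B = lcm d d'"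
proof -
  have d: "d = gcd d A * gcd d B" "d' = gcd d' A * gcd d' B"
    using assms(1-4) unfolding gcd_mult_coprime_split[OF assms(5), symmetric]
    by (simp_all add: gcd_proj1_if_dvd_int)
  show 1: "gcd d A * gcd d' B = gcd d d'"
  proof (rule zdvd_antisym_nonneg)
    have "coprime (gcd d A) (gcd d' B)"
      using assms(5) by (meson coprime_divisors gcd_dvd2)
    then show "gcd d A * gcd d' B dvd gcd d d'"
      using assms by (intro divides_mult gcd_greatest) auto
    have "gcd d d' = gcd (gcd d d') (A * B)"
      using dvd_trans[OF gcd_dvd1 assms(3)] by (simp add: gcd_proj1_if_dvd_int)
    also have "\<dots> = gcd (gcd d d') A * gcd (gcd d d') B"
      by (rule gcd_mult_coprime_split[OF assms(5)])
    also have "\<dots> dvd gcd d A * gcd d' B"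
      by (intro mult_dvd_mono gcd_mono) auto
    finally show "gcd d d' dvd gcd d A * gcd d' B" .
  qed auto
  \<comment> \<open>The four parts regroup to \<open>d * d'\<close>, so the second product is the
    cofactor of the gcd.\<close>
  have "gcd d d' * (gcd d' A * gcd d B) = (gcd d A * gcd d B) * (gcd d' A * gcd d' B)"
    unfolding 1[symmetric] by (simp only: mult_ac)
  also have "\<dots> = d * d'"
    unfolding d[symmetric] ..
  also have "\<dots> = gcd d d' * lcm d d'"
    using assms prod_gcd_lcm_int[of d d'] by simp
  finally show "gcd d' A * gcd d B = lcm d d'"
    using assms(1) by (subst (asm) mult_left_cancel) auto
qed

section \<open>Finiteness, stability and the extreme elements\<close>

theorem corollary1p4:
  fixes s :: nat and P :: "nat \<Rightarrow> 'r::finite int_mpoly"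
  assumes "s \<ge> 2"
    and "\<And>i. i \<in> {1..s} \<Longrightarrow> P i \<noteq> 0"
    and "\<not> (\<exists>z :: complex ^ 'r. \<forall>i\<in>{1..s}. mpoly_eval (P i) z = 0)"
  defines "D \<equiv> gcd_values s P"
  defines "Dpos \<equiv> {d \<in> D. d > 0}"
  shows "finite D
    \<and> (\<forall>d\<in>D. \<forall>d'\<in>D. gcd d d' \<in> D \<and> lcm d d' \<in> D)
    \<and> Dpos \<noteq> {}
    \<and> (\<forall>d\<in>D. Min Dpos dvd d)
    \<and> (\<forall>d\<in>D. d dvd Max Dpos)"
proof -
  obtain N :: int where N: "N > 0" "\<And>n. gcd_at s P n dvd N"
    using gcd_at_dvd_constant[OF assms(3)] by blast
  \<comment> \<open>A divisor of the positive \<open>N\<close> is not 0; hence all of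
    \<open>D\<close> is positive and bounded by \<open>N\<close>.\<close>
  have pos: "gcd_at s P n > 0" for n
  proof -
    have "gcd_at s P n \<ge> 0"
      by (simp add: gcd_at_def)
    moreover have "gcd_at s P n \<noteq> 0"
      using N by (metis dvd_0_left_iff less_irrefl)
    ultimately show ?thesis by simp
  qed
  have Dpos: "Dpos = D"
    using pos by (auto simp: Dpos_def D_def gcd_values_def)
  have "D \<subseteq> {0..N}"
    using pos N by (force simp: D_def gcd_values_def intro: less_imp_le zdvd_imp_le)
  then have fin: "finite D"
    by (rule finite_subset) simp
  have ne: "D \<noteq> {}"
    by (simp add: D_def gcd_values_def)
  have stable: "gcd d d' \<in> D \<and> lcm d d' \<in> D" if dd: "d \<in> D" "d' \<in> D" for d d'
  proof -
    obtain n n' where n: "d = gcd_at s P n" "d' = gcd_at s P n'"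
      using dd by (auto simp: D_def gcd_values_def)
    obtain A B where AB: "N = A * B" "coprime A B" "gcd d A dvd d'" "gcd d' B dvd d"
      using coprime_split[OF N(1)] by blast
    have eq: "gcd d A * gcd d' B = gcd d d'" "gcd d' A * gcd d B = lcm d d'"
      using coprime_split_gcd_lcm[of d d' A B] AB N pos n by auto
    obtain m where "gcd_at s P m = gcd d A * gcd d' B"
      using gcd_at_glue[OF AB(2)] N(2) n AB(1) by metis
    \<comment> \<open>The same splitting with \<open>n\<close> and \<open>n'\<close> exchanged picks
      the larger parts, that is, the lcm.\<close>
    moreover obtain m' where "gcd_at s P m' = gcd d' A * gcd d B"
      using gcd_at_glue[OF AB(2)] N(2) n AB(1) by metis
    ultimately show ?thesis
      unfolding eq D_def gcd_values_def by (metis rangeI)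
  qed
  have "Min D dvd d" if "d \<in> D" for d
  proof -
    have "Min D \<in> D"
      using fin ne by simp
    then have *: "gcd (Min D) d \<in> D" "Min D > 0"
      using stable[OF _ that] pos by (auto simp: D_def gcd_values_def)
    \<comment> \<open>The gcd is an element of \<open>D\<close> dividing the minimum, so it cannot
      be smaller.\<close>
    have "gcd (Min D) d = Min D"
      by (intro antisym zdvd_imp_le Min_le fin * gcd_dvd1)
    then show ?thesis
      by (metis gcd_dvd2)
  qed
  moreover have "d dvd Max D" if "d \<in> D" for d
  proof -
    have "Max D \<in> D"
      using fin ne by simp
    then have "lcm (Max D) d \<in> D" "Max D > 0"
      using stable[OF _ that] pos by (auto simp: D_def gcd_values_def)
    \<comment> \<open>Dually, the lcm lies in \<open>D\<close>, so it cannot exceed the maximum that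
      divides it.\<close>
    then have "lcm (Max D) d \<le> Max D" "lcm (Max D) d > 0"
      using fin pos by (auto simp: D_def gcd_values_def)
    then have "lcm (Max D) d = Max D"
      using zdvd_imp_le[OF dvd_lcm1] by (intro antisym)
    then show ?thesis
      by (metis dvd_lcm2)
  qed
  ultimately show ?thesis
    using fin ne stable unfolding Dpos by blast
qed

end
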